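(* Suppose $H\in\operatorname{BH}(n,3)$ admits an $H$-bent vector. Then \[ \frac23 n-\frac23\sqrt n\le r(C_H)\le \frac23 n-\frac13\sqrt n. \]
   Context: $\zeta_3=e^{2\pi\sqrt{-1}/3}$, $\langle\zeta_3\rangle$ the set of cube roots of unity. $\operatorname{BH}(n,3)$ is the set of $n\times n$ matrices $H$ with entries in $\langle\zeta_3\rangle$ and $HH^*=nI_n$. A vector $\mathbf x\in\langle\zeta_3\rangle^n$ is $H$-bent if every entry of $H\mathbf x$ has modulus $\sqrt n$. The logarithmic form $L(H)$ of $H=[\zeta_3^{\varphi_{i,j}}]$ is $[\varphi_{i,j}\bmod 3]$ over $\mathbb{Z}_3$; $R_H$ is the set of rows of $L(H)$ and $C_H=\bigcup_{\alpha\in\mathbb{Z}_3}(R_H+\alpha\mathbf 1)$. The covering radius of $C\subseteq\mathbb{Z}_3^n$ is $r(C)=\max_{\mathbf x\in\mathbb{Z}_3^n}\min_{\mathbf y\in C}d(\mathbf x,\mathbf y)$ with $d$ the Hamming distance. *)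

theory Defs
  imports "HOL-Analysis.Analysis"
begin

definition zeta3 :: complex where
  "zeta3 = exp (2 * of_real pi * \<i> / 3)"

definition cube_roots :: "complex set" where
  "cube_roots = {z. z ^ 3 = 1}"

definition conj_transpose :: "complex ^ 'n ^ 'm \<Rightarrow> complex ^ 'm ^ 'n" where
  "conj_transpose A = (\<chi> i j. cnj (A $ j $ i))"

text \<open>The order n of a matrix is the cardinality of the index type \<open>'n\<close>.
  For a scalar c, \<^term>\<open>mat c\<close> is c times the identity matrix.\<close>

definition BH3 :: "(complex ^ 'n ^ 'n) set" where
  "BH3 = {H. (\<forall>i j. H $ i $ j \<in> cube_roots) \<and>
             H ** conj_transpose H = mat (of_nat CARD('n))}"

definition is_bent :: "complex ^ 'n ^ 'n \<Rightarrow> complex ^ 'n \<Rightarrow> bool" where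
  "is_bent H x \<longleftrightarrow> (\<forall>i. x $ i \<in> cube_roots) \<and>
                 (\<forall>i. norm ((H *v x) $ i) = sqrt (real CARD('n)))"

text \<open>The numeral type \<open>3\<close> is the ring of integers modulo 3, so \<open>of_int\<close> into it is reduction
  modulo 3. By \<open>log_form_eq\<close> below, the chosen exponent does not matter.\<close>

definition log_form :: "complex ^ 'n ^ 'n \<Rightarrow> 3 ^ 'n ^ 'n" where
  "log_form H = (\<chi> i j. of_int (SOME k :: int. H $ i $ j = zeta3 powi k))"

definition log_rows :: "complex ^ 'n ^ 'n \<Rightarrow> (3 ^ 'n) set" where
  "log_rows H = rows (log_form H)"

definition log_code :: "complex ^ 'n ^ 'n \<Rightarrow> (3 ^ 'n) set" where
  "log_code H = (\<Union>a :: 3. (\<lambda>y. y + a *s vec 1) ` log_rows H)"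

definition hamming_dist :: "'a ^ 'n \<Rightarrow> 'a ^ 'n \<Rightarrow> nat" where
  "hamming_dist x y = card {i. x $ i \<noteq> y $ i}"

text \<open>Both extrema range over finite sets; the minimum is meaningful for nonempty \<open>C\<close>, and
  \<^term>\<open>log_code H\<close> is never empty.\<close>

definition covering_radius :: "(3 ^ 'n) set \<Rightarrow> nat" where
  "covering_radius C = (MAX x. MIN y\<in>C. hamming_dist x y)"

lemma zeta3_powi_eq_1_iff: "zeta3 powi k = 1 \<longleftrightarrow> 3 dvd k"
proof -
  have "zeta3 powi k = exp (of_int k * (2 * of_real pi * \<i> / 3))"
    unfolding zeta3_def by (simp add: exp_power_int)
  also have "\<dots> = 1 \<longleftrightarrow> (\<exists>n::int. real_of_int k * (2 * pi / 3) = of_int (2 * n) * pi)"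
    by (subst exp_eq_1) simp
  also have "\<dots> \<longleftrightarrow> (\<exists>n::int. k = 3 * n)"
  proof -
    have "real_of_int k * (2 * pi / 3) = of_int (2 * n) * pi \<longleftrightarrow> k = 3 * n" for n :: int
    proof -
      have "real_of_int k * (2 * pi / 3) = of_int (2 * n) * pi
            \<longleftrightarrow> real_of_int k * (2 * pi) = real_of_int (3 * n) * (2 * pi)"
        by (simp add: field_simps)
      also have "\<dots> \<longleftrightarrow> real_of_int k = real_of_int (3 * n)"
        by (subst mult_cancel_right) simp
      finally show ?thesis by (simp only: of_int_eq_iff)
    qed
    then show ?thesis by simp
  qed
  finally show ?thesis by (simp add: dvd_def)
qed

lemma log_form_eq:
  assumes "H $ i $ j = zeta3 powi k"
  shows "log_form H $ i $ j = of_int k"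
proof -
  define m where "m = (SOME m :: int. H $ i $ j = zeta3 powi m)"
  have "H $ i $ j = zeta3 powi m"
    unfolding m_def by (rule someI) (rule assms)
  moreover have "zeta3 \<noteq> 0" by (simp add: zeta3_def)
  ultimately have "zeta3 powi (m - k) = 1"
    using assms by (simp add: power_int_diff)
  then obtain q where "m - k = 3 * q" using zeta3_powi_eq_1_iff by (auto simp: dvd_def)
  then have "m = k + 3 * q" by simp
  have three: "(3 :: 3) = 0" by simp
  have "(of_int m :: 3) = of_int k + 3 * of_int q"
    by (simp only: \<open>m = k + 3 * q\<close> of_int_add of_int_mult of_int_numeral)
  also have "\<dots> = of_int k" by (simp only: three mult_zero_left add_0_right)
  finally show ?thesis by (simp add: log_form_def m_def[symmetric])
qed

end

theory Submission imports Defs begin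

text \<open>The distance from \<open>u\<close> to the codeword (row \<open>i\<close>) \<open>+ a\<one>\<close> is an affine function of the real
  part of \<open>\<zeta>\<^sup>a\<close> times the \<open>i\<close>-th entry of \<open>H x\<close>, where \<open>x\<^sub>j\<close> is \<open>\<zeta>\<close> to the power \<open>-u\<^sub>j\<close>. If \<open>x\<close> is bent, all these
  real parts are at most \<open>\<surd>n\<close>, which makes \<open>u\<close> far from the code. For an arbitrary \<open>x\<close>, Parseval
  yields an entry of modulus at least \<open>\<surd>n\<close>, and one of its three rotations by cube roots of unity
  has real part at least half the modulus, so that some codeword is near \<open>u\<close>.\<close>

text \<open>Exponents live in \<open>3\<close> itself, so no integer representative has to be chosen
  and code entries can be exponentiated directly.\<close>

definition zeta_pow :: "3 \<Rightarrow> complex" where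
  "zeta_pow a = (if a = 0 then 1 else if a = 1 then zeta3 else zeta3\<^sup>2)"

lemma exhaust_mod3: "(a :: 3) = 0 \<or> a = 1 \<or> a = 2"
  using exhaust_3[of a] by auto

lemma zeta3_eq: "zeta3 = Complex (- 1 / 2) (sqrt 3 / 2)"
proof -
  have "zeta3 = cis (2 * pi / 3)"
    by (simp add: zeta3_def cis_conv_exp mult_ac)
  then show ?thesis
    by (simp add: complex_eq_iff cos_120 sin_120)
qed

lemma zeta3_sq_eq: "zeta3\<^sup>2 = Complex (- 1 / 2) (- sqrt 3 / 2)"
  by (simp add: zeta3_eq power2_eq_square complex_eq_iff)

lemma zeta3_cubed: "zeta3 ^ 3 = 1"
  using zeta3_powi_eq_1_iff[of 3] by simp

lemma zeta_pow_add: "zeta_pow (a + b) = zeta_pow a * zeta_pow b"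
  using exhaust_mod3[of a] exhaust_mod3[of b] zeta3_cubed
  by (auto simp: zeta_pow_def power2_eq_square power3_eq_cube mult_ac)

lemma norm_zeta_pow [simp]: "norm (zeta_pow a) = 1"
  by (auto simp: zeta_pow_def norm_power zeta3_def norm_exp_eq_Re)

lemma Re_zeta_pow: "Re (zeta_pow a) = (if a = 0 then 1 else - 1 / 2)"
  by (auto simp: zeta_pow_def zeta3_sq_eq) (simp add: zeta3_eq)

lemma zeta_pow_in_cube_roots: "zeta_pow a \<in> cube_roots"
proof -
  have "(zeta3\<^sup>2) ^ 3 = (zeta3 ^ 3)\<^sup>2"
    by (simp flip: power_mult)
  then show ?thesis
    by (simp add: cube_roots_def zeta_pow_def zeta3_cubed)
qed

lemma cube_roots_eq_range: "cube_roots = range zeta_pow"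
proof
  show "range zeta_pow \<subseteq> cube_roots"
    using zeta_pow_in_cube_roots by auto
next
  have "z \<in> range zeta_pow" if "z ^ 3 = 1" for z
  proof -
    have "zeta3 + zeta3\<^sup>2 = - 1"
      unfolding zeta3_sq_eq by (simp add: zeta3_eq complex_eq_iff)
    \<comment> \<open>The relations 1 + zeta + zeta^2 = 0 and zeta^3 = 1 fix all elementary
      symmetric functions of the three roots.\<close>
    then have "(z - 1) * (z - zeta3) * (z - zeta3\<^sup>2) = z ^ 3 - 1"
      using zeta3_cubed by algebra
    then have "z = zeta_pow 0 \<or> z = zeta_pow 1 \<or> z = zeta_pow 2"
      using that by (auto simp: zeta_pow_def)
    then show ?thesis by auto
  qed
  then show "cube_roots \<subseteq> range zeta_pow"
    by (auto simp: cube_roots_def)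
qed

text \<open>This removes the choice operator inside \<open>log_form\<close>: from here on
  \<open>log_form\<close> is used only as an exponent matrix of \<open>H\<close>.\<close>

lemma zeta_pow_log_form:
  assumes "H $ i $ j \<in> cube_roots"
  shows "zeta_pow (log_form H $ i $ j) = H $ i $ j"
proof -
  obtain a where a: "H $ i $ j = zeta_pow a"
    using assms by (auto simp: cube_roots_eq_range)
  have "\<exists>k. zeta_pow a = zeta3 powi k \<and> of_int k = a"
    using exhaust_mod3[of a]
    by (elim disjE) (force simp: zeta_pow_def intro: exI[of _ 0] exI[of _ 1] exI[of _ 2])+
  then show ?thesis
    using a log_form_eq by metis
qed

text \<open>The real parts \<open>r\<close>, \<open>s\<close>, \<open>t\<close> of the three
  rotations have sum 0 and second elementary symmetric function -3/4 |z|^2. Hence the derivative of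
  (T - r)(T - s)(T - t) is 3 T^2 - 3/4 |z|^2, which vanishes at T = |z|/2. If all three roots lay
  below that point, the derivative there would be positive.\<close>

lemma exists_rotation_Re_ge:
  "\<exists>a. norm z / 2 \<le> Re (zeta_pow a * z)"
proof (rule ccontr)
  assume "\<not> ?thesis"
  then have less: "Re (zeta_pow a * z) < norm z / 2" for a
    by (auto simp: not_le)
  define r s t where "r = Re (zeta_pow 0 * z)" and "s = Re (zeta_pow 1 * z)"
    and "t = Re (zeta_pow 2 * z)"
  have r: "r = Re z" by (simp add: r_def zeta_pow_def)
  have s: "s = - Re z / 2 - sqrt 3 / 2 * Im z" by (simp add: s_def zeta_pow_def zeta3_eq)
  have t: "t = - Re z / 2 + sqrt 3 / 2 * Im z" by (simp add: t_def zeta_pow_def zeta3_sq_eq)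
  define m where "m = norm z / 2"
  have "r < m" "s < m" "t < m"
    using less by (simp_all add: r_def s_def t_def m_def)
  then have "0 < (m - r) * (m - s) + (m - s) * (m - t) + (m - t) * (m - r)"
    by (intro add_pos_pos mult_pos_pos) auto
  also have "\<dots> = 3 * m\<^sup>2 - 2 * m * (r + s + t) + (r * (s + t) + s * t)"
    by (simp add: algebra_simps power2_eq_square)
  also have "\<dots> = 3 * m\<^sup>2 - 3 / 4 * ((Re z)\<^sup>2 + (Im z)\<^sup>2)"
    by (simp add: r s t algebra_simps power2_eq_square)
  also have "\<dots> = 0"
    by (simp add: m_def power_divide flip: cmod_power2)
  finally show False by simp
qed

text \<open>Each nonzero exponent contributes -1/2 in place of 1, a loss of 3/2.\<close>

lemma Re_sum_zeta_pow:
  fixes w :: "'n::finite \<Rightarrow> 3"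
  shows "Re (\<Sum>j\<in>UNIV. zeta_pow (w j)) = real CARD('n) - 3 / 2 * real (card {j. w j \<noteq> 0})"
proof -
  have "Re (\<Sum>j\<in>UNIV. zeta_pow (w j)) = (\<Sum>j\<in>UNIV. 1 - 3 / 2 * of_bool (w j \<noteq> 0))"
    by (auto simp: Re_zeta_pow intro!: sum.cong)
  also have "\<dots> = real CARD('n) - 3 / 2 * real (card {j. w j \<noteq> 0})"
    by (simp only: sum_subtractf sum_distrib_left[symmetric]) simp
  finally show ?thesis .
qed

text \<open>The \<open>j\<close>-th term of the rotated entry is a power of zeta whose exponent is
  the difference of the codeword and \<open>u\<close> at \<open>j\<close>; it is zero exactly where
  the two agree, so \<open>Re_sum_zeta_pow\<close> counts the disagreements.\<close>

lemma hamming_dist_log_row: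
  fixes H :: "complex ^ 'n ^ 'n"
  assumes "\<And>i j. H $ i $ j \<in> cube_roots"
  shows "real (hamming_dist u (row i (log_form H) + a *s vec 1)) =
    2 / 3 * real CARD('n) - 2 / 3 * Re (zeta_pow a * (H *v (\<chi> j. zeta_pow (- u $ j))) $ i)"
proof -
  let ?w = "\<lambda>j. a + (log_form H $ i $ j + - u $ j)"
  have "zeta_pow a * (H *v (\<chi> j. zeta_pow (- u $ j))) $ i = (\<Sum>j\<in>UNIV. zeta_pow (?w j))"
    using assms
    by (simp only: matrix_vector_mult_def vec_lambda_beta zeta_pow_add zeta_pow_log_form
        sum_distrib_left)
  moreover have "hamming_dist u (row i (log_form H) + a *s vec 1) = card {j. ?w j \<noteq> 0}"
    unfolding hamming_dist_def row_def
    by (rule arg_cong[of _ _ card]) (auto simp: algebra_simps)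
  ultimately show ?thesis
    by (simp only: Re_sum_zeta_pow) (simp add: field_simps)
qed

text \<open>Parseval's identity. A right inverse of a square matrix is also a left inverse, so the
  hypothesis on the rows of \<open>H\<close> transfers to the columns; then the squared norm of
  \<open>H *v x\<close> is the inner product of \<open>x\<close> with
  \<open>conj_transpose H ** H\<close> applied to \<open>x\<close>.\<close>

lemma sum_norm_matrix_vector_mult_sq:
  fixes H :: "complex ^ 'n ^ 'n"
  assumes "H ** conj_transpose H = mat (of_real c)" "c \<noteq> 0"
  shows "(\<Sum>i\<in>UNIV. (norm ((H *v x) $ i))\<^sup>2) = c * (\<Sum>j\<in>UNIV. (norm (x $ j))\<^sup>2)"
proof -
  \<comment> \<open>The candidate inverse of \<open>H\<close>, available because \<open>c\<close> is
    nonzero.\<close>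
  define K where "K = mat (inverse (of_real c)) ** conj_transpose H"
  have mat_mult: "mat d ** A = (\<chi> i j. d * A $ i $ j)" for d and A :: "complex ^ 'n ^ 'n"
    by (simp add: mat_def matrix_matrix_mult_def vec_eq_iff if_distrib if_distribR cong: if_cong)
  have "K = (\<chi> i j. inverse (of_real c) * conj_transpose H $ i $ j)"
    by (simp add: K_def mat_mult)
  then have "(H ** K) $ i $ j = inverse (of_real c) * (H ** conj_transpose H) $ i $ j" for i j
    by (simp add: matrix_matrix_mult_def sum_distrib_left mult_ac)
  then have "H ** K = mat 1"
    using assms by (simp add: vec_eq_iff mat_def)
  then have "K ** H = mat 1"
    by (simp add: matrix_left_right_inverse)
  then have "mat (of_real c) ** (K ** H) = mat (of_real c)"
    by simp
  moreover have "mat (of_real c) ** K = conj_transpose H"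
    using assms(2) by (simp add: K_def mat_mult vec_eq_iff)
  ultimately have gram: "conj_transpose H ** H = mat (of_real c)"
    by (simp add: matrix_mul_assoc)
  have inner_sq: "(\<Sum>i\<in>UNIV. cnj (v $ i) * v $ i) = of_real (\<Sum>i\<in>UNIV. (norm (v $ i))\<^sup>2)"
    for v :: "complex ^ 'n"
    by (simp only: of_real_sum complex_norm_square mult.commute)
  have adjoint: "(\<Sum>i\<in>UNIV. cnj ((H *v x) $ i) * y $ i) =
      (\<Sum>j\<in>UNIV. cnj (x $ j) * (conj_transpose H *v y) $ j)" for y
  proof -
    have "(\<Sum>i\<in>UNIV. cnj ((H *v x) $ i) * y $ i) =
        (\<Sum>i\<in>UNIV. \<Sum>j\<in>UNIV. cnj (H $ i $ j) * cnj (x $ j) * y $ i)"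
      by (simp add: matrix_vector_mult_def sum_distrib_right)
    also have "\<dots> = (\<Sum>j\<in>UNIV. \<Sum>i\<in>UNIV. cnj (H $ i $ j) * cnj (x $ j) * y $ i)"
      by (rule sum.swap)
    finally show ?thesis
      by (simp add: matrix_vector_mult_def conj_transpose_def sum_distrib_left mult_ac)
  qed
  have "complex_of_real (\<Sum>i\<in>UNIV. (norm ((H *v x) $ i))\<^sup>2) =
      (\<Sum>j\<in>UNIV. cnj (x $ j) * (mat (of_real c) *v x) $ j)"
    by (simp only: adjoint matrix_vector_mul_assoc gram flip: inner_sq)
  also have "mat (of_real c) *v x = (\<chi> j. of_real c * x $ j)"
    by (simp add: mat_def matrix_vector_mult_def vec_eq_iff if_distrib if_distribR cong: if_cong)
  also have "(\<Sum>j\<in>UNIV. cnj (x $ j) * (\<chi> j. of_real c * x $ j) $ j) =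
      of_real c * (\<Sum>j\<in>UNIV. cnj (x $ j) * x $ j)"
    by (simp add: sum_distrib_left mult_ac)
  also have "\<dots> = of_real (c * (\<Sum>j\<in>UNIV. (norm (x $ j))\<^sup>2))"
    by (simp only: inner_sq of_real_mult)
  finally show ?thesis
    by (simp only: of_real_eq_iff)
qed

text \<open>By Parseval the squared moduli of the n entries sum to n^2, so they cannot all be below
  their mean n.\<close>

lemma BH3_exists_large_entry:
  fixes H :: "complex ^ 'n ^ 'n"
  assumes "H \<in> BH3" "\<And>j. norm (x $ j) = 1"
  shows "\<exists>i. sqrt (real CARD('n)) \<le> norm ((H *v x) $ i)"
proof (rule ccontr)
  assume "\<not> ?thesis"
  then have "norm ((H *v x) $ i) < sqrt (real CARD('n))" for i
    by (auto simp: not_le)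
  then have "(norm ((H *v x) $ i))\<^sup>2 < (sqrt (real CARD('n)))\<^sup>2" for i
    by (intro power_strict_mono) auto
  then have "(\<Sum>i\<in>UNIV. (norm ((H *v x) $ i))\<^sup>2) < (\<Sum>i\<in>(UNIV :: 'n set). real CARD('n))"
    by (intro sum_strict_mono) auto
  moreover have "(\<Sum>i\<in>UNIV. (norm ((H *v x) $ i))\<^sup>2) = real CARD('n) * (\<Sum>j\<in>(UNIV :: 'n set). 1)"
    using sum_norm_matrix_vector_mult_sq[of H "real CARD('n)" x] assms by (simp add: BH3_def)
  ultimately show False by simp
qed

lemma log_code_eq: "log_code H = (\<Union>i a. {row i (log_form H) + a *s vec 1})"
  by (auto simp: log_code_def log_rows_def rows_def)

lemma covering_radius_le:
  assumes "\<And>u. \<exists>y\<in>C. real (hamming_dist u y) \<le> r"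
  shows "real (covering_radius C) \<le> r"
proof -
  have "covering_radius C \<in> range (\<lambda>u. MIN y\<in>C. hamming_dist u y)"
    unfolding covering_radius_def by (rule Max_in) auto
  then obtain u where u: "covering_radius C = (MIN y\<in>C. hamming_dist u y)"
    by auto
  obtain y where "y \<in> C" "real (hamming_dist u y) \<le> r"
    using assms by blast
  moreover from this have "(MIN y\<in>C. hamming_dist u y) \<le> hamming_dist u y"
    by (intro Min_le) auto
  ultimately show ?thesis
    using u by linarith
qed

lemma covering_radius_ge:
  assumes "C \<noteq> {}" "\<And>y. y \<in> C \<Longrightarrow> r \<le> real (hamming_dist u y)"
  shows "r \<le> real (covering_radius C)"
proof -
  \<comment> \<open>Nonemptiness of \<open>C\<close> ensures that the minimum is an actual distance
    to a codeword.\<close>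
  have "(MIN y\<in>C. hamming_dist u y) \<in> hamming_dist u ` C"
    using assms(1) by (intro Min_in) auto
  then have "r \<le> real (MIN y\<in>C. hamming_dist u y)"
    using assms(2) by auto
  also have "(MIN y\<in>C. hamming_dist u y) \<le> covering_radius C"
    unfolding covering_radius_def by (rule Max_ge) auto
  finally show ?thesis by simp
qed

theorem theorem5p6:
  fixes H :: "complex ^ 'n ^ 'n"
  assumes "H \<in> BH3"
    and "\<exists>x. is_bent H x"
  shows "2 / 3 * real CARD('n) - 2 / 3 * sqrt (real CARD('n)) \<le> real (covering_radius (log_code H)) \<and>
         real (covering_radius (log_code H)) \<le> 2 / 3 * real CARD('n) - 1 / 3 * sqrt (real CARD('n))"
proof
  have roots: "H $ i $ j \<in> cube_roots" for i j
    using assms(1) by (simp add: BH3_def)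
  obtain x where x: "is_bent H x"
    using assms(2) by blast
  then have "\<forall>j. \<exists>a. x $ j = zeta_pow a"
    by (auto simp: is_bent_def cube_roots_eq_range)
  then obtain v where v: "\<And>j. x $ j = zeta_pow (v j)"
    by metis
  \<comment> \<open>The distance formula evaluates \<open>H\<close> at powers with exponents
    \<open>- u $ j\<close>, so the far vector is the negated logarithm of the bent one.\<close>
  define u where "u = (\<chi> j. - v j)"
  have x_eq: "(\<chi> j. zeta_pow (- u $ j)) = x"
    by (simp add: u_def v vec_eq_iff)
  \<comment> \<open>Rotation preserves the modulus, so bentness bounds the real part for every
    translate \<open>a\<close> at once.\<close>
  have "Re (zeta_pow a * (H *v x) $ i) \<le> sqrt (real CARD('n))" for a i
    using complex_Re_le_cmod[of "zeta_pow a * (H *v x) $ i"] x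
    by (simp add: norm_mult is_bent_def)
  then have "2 / 3 * real CARD('n) - 2 / 3 * sqrt (real CARD('n)) \<le>
      real (hamming_dist u (row i (log_form H) + a *s vec 1))" for i a
    unfolding hamming_dist_log_row[OF roots] x_eq by (simp del: times_complex.sel)
  then show "2 / 3 * real CARD('n) - 2 / 3 * sqrt (real CARD('n)) \<le> real (covering_radius (log_code H))"
    unfolding log_code_eq by (intro covering_radius_ge[of _ _ u]) blast+
  show "real (covering_radius (log_code H)) \<le> 2 / 3 * real CARD('n) - 1 / 3 * sqrt (real CARD('n))"
  proof (rule covering_radius_le)
    fix u :: "3 ^ 'n"
    let ?x = "\<chi> j. zeta_pow (- u $ j)"
    obtain i where i: "sqrt (real CARD('n)) \<le> norm ((H *v ?x) $ i)"
      using BH3_exists_large_entry[OF assms(1), of ?x] by auto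
    \<comment> \<open>The rotation picks the translate of row \<open>i\<close>; the factor 1/2 lost
      here turns the coefficient 2/3 into 1/3.\<close>
    obtain a where "norm ((H *v ?x) $ i) / 2 \<le> Re (zeta_pow a * (H *v ?x) $ i)"
      using exists_rotation_Re_ge by blast
    with i have "real (hamming_dist u (row i (log_form H) + a *s vec 1)) \<le>
        2 / 3 * real CARD('n) - 1 / 3 * sqrt (real CARD('n))"
      unfolding hamming_dist_log_row[OF roots] by linarith
    then show "\<exists>y\<in>log_code H. real (hamming_dist u y) \<le>
        2 / 3 * real CARD('n) - 1 / 3 * sqrt (real CARD('n))"
      unfolding log_code_eq by blast
  qed
qed

end
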